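(* Let $X$ be a Banach function space over $[0,1]$ with $1\in X_a$, and let $\{L_n\}_{n\in\mathbb{N}}$ be a sequence of positive linear operators $L_n:X^S\to X^S$. Suppose that $\sup_n\|L_n(1)\|_X=c<+\infty$. For $n\in\mathbb{N}$ let $\mu_n\ge0$ be defined by $$\mu_n^2=\big\|\,x\mapsto L_n((x-\cdot)^2)(x)\,\big\|_X .$$ Then for every $f\in C[0,1]$ and every $n=1,2,3,\ldots$, $$\|L_n(f)-f\|_X\le\|f\|_\infty\|L_n(1)-1\|_X+(\|L_n(1)\|_X+1)\,\omega(f,\mu_n),$$ and if $L_n(1)=1$ then $$\|L_n(f)-f\|_X\le(c+1)\,\omega(f,\mu_n).$$ Moreover, if $f$ is differentiable with $f'\in C[0,1]$, then $$\|L_n(f)-f\|_X\le\|f\|_\infty\|L_n(1)-1\|_X+\sqrt{c}\,\mu_n\|f'\|_\infty+(\sqrt{c}+1)\,\mu_n\,\omega(f',\mu_n),$$ and if in addition $L_n(1)=1$, then $$\|L_n(f)-f\|_X\le\sqrt{c}\,\mu_n\|f'\|_\infty+(\sqrt{c}+1)\,\mu_n\,\omega(f',\mu_n).$$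
   Context: Work on $[0,1]$ with the Borel $\sigma$-algebra $\mathcal{S}$ and Lebesgue measure $\mu$. Let $\mathcal{M}$ be the set of measurable functions on $[0,1]$ (identified when equal a.e.) and $\mathcal{M}^+$ the non-negative ones. A map $\rho:\mathcal{M}^+\to[0,+\infty]$ is a function norm if for all $f,g,f_n\in\mathcal{M}^+$, $a\ge 0$, $E\in\mathcal{S}$: (i) $\rho(f)=0\iff f=0$ a.e., $\rho(af)=a\rho(f)$, $\rho(f+g)\le\rho(f)+\rho(g)$; (ii) $g\le f$ a.e. implies $\rho(g)\le\rho(f)$; (iii) $f_n\uparrow f$ a.e. implies $\rho(f_n)\uparrow\rho(f)$; (iv) $\mu(E)<\infty$ implies $\rho(\chi_E)<\infty$; (v) $\mu(E)<\infty$ implies there is $C_E>0$, depending only on $E$ and $\rho$, with $\int_E f\,d\mu\le C_E\rho(f)$. The Banach function space $X$ generated by $\rho$ is the space of $f\in\mathcal{M}$ with $\|f\|_X:=\rho(|f|)<\infty$. A function $f\in X$ has absolutely continuous norm if $\|f\chi_{E_n}\|_X\to0$ for every sequence $E_n\in\mathcal{S}$ with $E_n\to\emptyset$ a.e. (i.e. $\chi_{E_n}\to0$ a.e.); $X_a$ is the set of all such $f$. Here $1$ is the constant function. For $\delta>0$, $T_\delta f(x)=f(x+\delta)$ if $x+\delta\in[0,1]$ and $T_\delta f(x)=0$ otherwise. $X^S$ is the closure in $X$ of $\{f\in X:\lim_{\delta\to0}\|T_\delta f-f\|_X=0\}$, with the norm of $X$. When $1\in X_a$ one has $C[0,1]\subset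 X^S$. A linear operator $L$ on $X^S$ is positive if $f\ge0$ a.e. implies $L(f)\ge0$ a.e. $C[0,1]$ is the space of real-valued continuous functions on $[0,1]$ and $\|\cdot\|_\infty$ is the sup-norm. With $e_i(t)=t^i$, the function $x\mapsto L_n((x-\cdot)^2)(x)$ is, a.e., $x^2L_n(e_0)(x)-2x\,L_n(e_1)(x)+L_n(e_2)(x)$. The modulus of continuity of $f$ is $\omega(f,\delta)=\sup\{|f(x)-f(y)|:x,y\in[0,1],\ |x-y|\le\delta\}$ for $\delta>0$; by the same formula $\omega(f,0)=0$. *)

theory Defs
  imports "HOL-Analysis.Analysis"
begin

text \<open>
  Elements of the spaces below are represented by functions \<^typ>\<open>real \<Rightarrow> real\<close>; identification of
  a.e. equal functions is expressed by stating every equality and inequality between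
  them almost everywhere. For functions on the unit interval the values outside it are irrelevant.
\<close>

definition measurable_nonneg :: "'a measure \<Rightarrow> ('a \<Rightarrow> real) set" where
  "measurable_nonneg M = {f \<in> borel_measurable M. AE x in M. 0 \<le> f x}"

text \<open>
  The norm is only constrained on \<^term>\<open>measurable_nonneg M\<close>, i.e. on finite-valued functions.
  A function norm on \<open>[0,\<infinity>]\<close>-valued functions restricts to one in this sense and generates the
  same space, since by the last axiom a function of finite norm is integrable on sets of finite
  measure.
\<close>

definition function_norm :: "'a measure \<Rightarrow> (('a \<Rightarrow> real) \<Rightarrow> ennreal) \<Rightarrow> bool" where
  "function_norm M \<rho> \<longleftrightarrow>
     (\<forall>f\<in>measurable_nonneg M. \<rho> f = 0 \<longleftrightarrow> (AE x in M. f x = 0)) \<and>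
     (\<forall>f\<in>measurable_nonneg M. \<forall>a\<ge>0. \<rho> (\<lambda>x. a * f x) = ennreal a * \<rho> f) \<and>
     (\<forall>f\<in>measurable_nonneg M. \<forall>g\<in>measurable_nonneg M. \<rho> (\<lambda>x. f x + g x) \<le> \<rho> f + \<rho> g) \<and>
     (\<forall>f\<in>measurable_nonneg M. \<forall>g\<in>measurable_nonneg M.
        (AE x in M. g x \<le> f x) \<longrightarrow> \<rho> g \<le> \<rho> f) \<and>
     (\<forall>F f. (\<forall>n. F n \<in> measurable_nonneg M) \<longrightarrow> f \<in> measurable_nonneg M \<longrightarrow>
        (AE x in M. incseq (\<lambda>n::nat. F n x) \<and> (\<lambda>n. F n x) \<longlonglongrightarrow> f x) \<longrightarrow>
        incseq (\<lambda>n. \<rho> (F n)) \<and> (\<lambda>n. \<rho> (F n)) \<longlonglongrightarrow> \<rho> f) \<and>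
     (\<forall>E\<in>sets M. emeasure M E < \<infinity> \<longrightarrow> \<rho> (indicator E) < \<infinity>) \<and>
     (\<forall>E\<in>sets M. emeasure M E < \<infinity> \<longrightarrow>
        (\<exists>C>0. \<forall>f\<in>measurable_nonneg M.
           (\<integral>\<^sup>+x\<in>E. ennreal (f x) \<partial>M) \<le> ennreal C * \<rho> f))"

text \<open>
  The norm is extended-valued, so that no default value is assigned to functions outside the
  space; \<open>T\<^sub>\<delta> f\<close> below may leave the space.
\<close>

definition bfs_norm :: "(('a \<Rightarrow> real) \<Rightarrow> ennreal) \<Rightarrow> ('a \<Rightarrow> real) \<Rightarrow> ennreal" where
  "bfs_norm \<rho> f = \<rho> (\<lambda>x. \<bar>f x\<bar>)"

definition bfs :: "'a measure \<Rightarrow> (('a \<Rightarrow> real) \<Rightarrow> ennreal) \<Rightarrow> ('a \<Rightarrow> real) set" where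
  "bfs M \<rho> = {f \<in> borel_measurable M. bfs_norm \<rho> f < \<infinity>}"

definition abs_cont_norm :: "'a measure \<Rightarrow> (('a \<Rightarrow> real) \<Rightarrow> ennreal) \<Rightarrow> ('a \<Rightarrow> real) set" where
  "abs_cont_norm M \<rho> = {f \<in> bfs M \<rho>.
     \<forall>E :: nat \<Rightarrow> 'a set. (\<forall>n. E n \<in> sets M) \<longrightarrow>
       (AE x in M. (\<lambda>n. indicator (E n) x :: real) \<longlonglongrightarrow> 0) \<longrightarrow>
       (\<lambda>n. bfs_norm \<rho> (\<lambda>x. f x * indicator (E n) x)) \<longlonglongrightarrow> 0}"

abbreviation unit_lborel :: "real measure" where
  "unit_lborel \<equiv> restrict_space lborel {0..1}"

definition shift :: "real \<Rightarrow> (real \<Rightarrow> real) \<Rightarrow> real \<Rightarrow> real" where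
  "shift \<delta> f x = (if x + \<delta> \<in> {0..1} then f (x + \<delta>) else 0)"

definition shift_continuous :: "((real \<Rightarrow> real) \<Rightarrow> ennreal) \<Rightarrow> (real \<Rightarrow> real) set" where
  "shift_continuous \<rho> = {f \<in> bfs unit_lborel \<rho>.
     ((\<lambda>\<delta>. bfs_norm \<rho> (\<lambda>x. shift \<delta> f x - f x)) \<longlongrightarrow> 0) (at_right 0)}"

text \<open>The space \<open>X\<^sup>S\<close>: the norm closure of \<^const>\<open>shift_continuous\<close> in \<^const>\<open>bfs\<close>.\<close>

definition bfs_S :: "((real \<Rightarrow> real) \<Rightarrow> ennreal) \<Rightarrow> (real \<Rightarrow> real) set" where
  "bfs_S \<rho> = {f \<in> bfs unit_lborel \<rho>.
     \<forall>\<epsilon>>0. \<exists>g\<in>shift_continuous \<rho>. bfs_norm \<rho> (\<lambda>x. f x - g x) < \<epsilon>}"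

text \<open>The second clause says that \<open>L\<close> is well defined on classes of a.e. equal functions.\<close>

definition positive_linear_operator ::
    "'a measure \<Rightarrow> ('a \<Rightarrow> real) set \<Rightarrow> (('a \<Rightarrow> real) \<Rightarrow> 'a \<Rightarrow> real) \<Rightarrow> bool" where
  "positive_linear_operator M V L \<longleftrightarrow>
     (\<forall>f\<in>V. L f \<in> V) \<and>
     (\<forall>f\<in>V. \<forall>g\<in>V. (AE x in M. f x = g x) \<longrightarrow> (AE x in M. L f x = L g x)) \<and>
     (\<forall>f\<in>V. \<forall>g\<in>V. AE x in M. L (\<lambda>t. f t + g t) x = L f x + L g x) \<and>
     (\<forall>f\<in>V. \<forall>a. AE x in M. L (\<lambda>t. a * f t) x = a * L f x) \<and>
     (\<forall>f\<in>V. (AE x in M. 0 \<le> f x) \<longrightarrow> (AE x in M. 0 \<le> L f x))"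

text \<open>
  The function \<open>x \<mapsto> L((x - \<cdot>)\<^sup>2)(x)\<close>. As \<open>L f\<close> is determined only up to null sets,
  it is given by its expansion in \<open>L(e\<^sub>0), L(e\<^sub>1), L(e\<^sub>2)\<close>, where \<open>e\<^sub>i(t) = t\<^sup>i\<close>.
\<close>

definition second_moment :: "((real \<Rightarrow> real) \<Rightarrow> real \<Rightarrow> real) \<Rightarrow> real \<Rightarrow> real" where
  "second_moment L x =
     x\<^sup>2 * L (\<lambda>t. t ^ 0) x - 2 * x * L (\<lambda>t. t ^ 1) x + L (\<lambda>t. t ^ 2) x"

definition sup_norm :: "(real \<Rightarrow> real) \<Rightarrow> real" where
  "sup_norm f = (SUP x\<in>{0..1}. \<bar>f x\<bar>)"

definition modulus :: "(real \<Rightarrow> real) \<Rightarrow> real \<Rightarrow> real" where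
  "modulus f \<delta> = Sup {\<bar>f x - f y\<bar> | x y. x \<in> {0..1} \<and> y \<in> {0..1} \<and> \<bar>x - y\<bar> \<le> \<delta>}"

end

(* If |f t - f x| <= A + B (t - x)^2 on the unit interval, positivity of L gives
   |L f - f L 1| <= A L 1 + B s a.e., where s is the second moment; taking norms,
   ||L f - f|| <= ||f||_inf ||L 1 - 1|| + A ||L 1|| + B mu^2.  For continuous f take
   A = omega(f, mu) and B = omega(f, mu) / mu^2 (a limit if mu = 0).  If f' is continuous,
   the mean value theorem and 2 |t - x| <= eps + (t - x)^2 / eps give A = ||f'||_inf eps / 2 and
   B = ||f'||_inf / (2 eps), and optimising over eps yields sqrt c mu ||f'||_inf. *)

theory Submission
  imports Defs
begin

section \<open>Function norms: domination\<close>

lemma function_norm_mono: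
  assumes "function_norm M \<rho>" "f \<in> measurable_nonneg M" "g \<in> measurable_nonneg M"
    and "AE x in M. g x \<le> f x"
  shows "\<rho> g \<le> \<rho> f"
  using assms unfolding function_norm_def by blast

lemma function_norm_add:
  assumes "function_norm M \<rho>" "f \<in> measurable_nonneg M" "g \<in> measurable_nonneg M"
  shows "\<rho> (\<lambda>x. f x + g x) \<le> \<rho> f + \<rho> g"
  using assms unfolding function_norm_def by blast

lemma function_norm_cmult:
  assumes "function_norm M \<rho>" "f \<in> measurable_nonneg M" "0 \<le> a"
  shows "\<rho> (\<lambda>x. a * f x) = ennreal a * \<rho> f"
  using assms unfolding function_norm_def by blast

text \<open>Monotonicity, subadditivity and homogeneity in one step: every norm estimate below comes
  from a pointwise a.e. bound of this shape. A single dominating function is the case of a zero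
  coefficient.\<close>

lemma bfs_norm_dominated:
  assumes \<rho>: "function_norm M \<rho>"
    and [measurable]: "f \<in> borel_measurable M" "g \<in> borel_measurable M" "h \<in> borel_measurable M"
    and nn: "0 \<le> a" "0 \<le> b"
    and le: "AE x in M. \<bar>f x\<bar> \<le> a * \<bar>g x\<bar> + b * \<bar>h x\<bar>"
  shows "bfs_norm \<rho> f \<le> ennreal a * bfs_norm \<rho> g + ennreal b * bfs_norm \<rho> h"
proof -
  have m: "(\<lambda>x. \<bar>f x\<bar>) \<in> measurable_nonneg M" "(\<lambda>x. \<bar>g x\<bar>) \<in> measurable_nonneg M"
    "(\<lambda>x. \<bar>h x\<bar>) \<in> measurable_nonneg M" "(\<lambda>x. a * \<bar>g x\<bar>) \<in> measurable_nonneg M"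
    "(\<lambda>x. b * \<bar>h x\<bar>) \<in> measurable_nonneg M"
    "(\<lambda>x. a * \<bar>g x\<bar> + b * \<bar>h x\<bar>) \<in> measurable_nonneg M"
    using nn by (auto simp: measurable_nonneg_def)
  have "\<rho> (\<lambda>x. \<bar>f x\<bar>) \<le> \<rho> (\<lambda>x. a * \<bar>g x\<bar> + b * \<bar>h x\<bar>)"
    by (rule function_norm_mono[OF \<rho> m(6) m(1) le])
  also have "\<dots> \<le> \<rho> (\<lambda>x. a * \<bar>g x\<bar>) + \<rho> (\<lambda>x. b * \<bar>h x\<bar>)"
    by (rule function_norm_add[OF \<rho> m(4) m(5)])
  finally show ?thesis
    by (simp add: bfs_norm_def function_norm_cmult[OF \<rho> m(2) nn(1)]
        function_norm_cmult[OF \<rho> m(3) nn(2)])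
qed

lemma bfs_norm_eq_0:
  assumes "function_norm M \<rho>" "f \<in> borel_measurable M" "AE x in M. f x = 0"
  shows "bfs_norm \<rho> f = 0"
  using bfs_norm_dominated[OF assms(1,2,2,2), of 0 0] assms(3) by simp

section \<open>Sup-norm and modulus of continuity\<close>

lemma abs_le_sup_norm:
  assumes "continuous_on {0..1} f" "x \<in> {0..1}"
  shows "\<bar>f x\<bar> \<le> sup_norm f"
proof -
  have "bdd_above ((\<lambda>x. \<bar>f x\<bar>) ` {0..1})"
    by (intro bounded_imp_bdd_above compact_imp_bounded compact_continuous_image
        continuous_intros assms(1) compact_Icc)
  then show ?thesis
    unfolding sup_norm_def using assms(2) by (rule cSUP_upper2) simp
qed

lemma sup_norm_nonneg:
  assumes "continuous_on {0..1} f"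
  shows "0 \<le> sup_norm f"
  using abs_le_sup_norm[OF assms, of 0] by force

lemma modulus_ge:
  assumes "continuous_on {0..1} f" "x \<in> {0..1}" "y \<in> {0..1}" "\<bar>x - y\<bar> \<le> \<delta>"
  shows "\<bar>f x - f y\<bar> \<le> modulus f \<delta>"
proof -
  have "\<bar>f u - f v\<bar> \<le> 2 * sup_norm f" if "u \<in> {0..1}" "v \<in> {0..1}" for u v
    using abs_le_sup_norm[OF assms(1) that(1)] abs_le_sup_norm[OF assms(1) that(2)] by linarith
  then have "bdd_above {\<bar>f x - f y\<bar> | x y. x \<in> {0..1} \<and> y \<in> {0..1} \<and> \<bar>x - y\<bar> \<le> \<delta>}"
    by (intro bdd_aboveI[of _ "2 * sup_norm f"]) blast
  then show ?thesis
    unfolding modulus_def using assms(2-4) by (intro cSup_upper) auto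
qed

lemma modulus_nonneg:
  assumes "continuous_on {0..1} f" "0 \<le> \<delta>"
  shows "0 \<le> modulus f \<delta>"
  using modulus_ge[OF assms(1), of 0 0 \<delta>] assms(2) by simp

lemma modulus_0: "modulus f 0 = 0"
proof -
  have "{\<bar>f x - f y\<bar> | x y. x \<in> {0..1} \<and> y \<in> {0..1} \<and> \<bar>x - y\<bar> \<le> 0} = {0}"
    by (auto intro!: exI[of _ "0::real"])
  then show ?thesis
    by (simp add: modulus_def)
qed

section \<open>Quadratic bounds for increments\<close>

text \<open>Cut the segment from \<open>x\<close> to \<open>t\<close> into \<open>Suc n\<close>
  equal pieces, each of length at most \<open>\<delta>\<close>, and add the increments. The
  induction splits off the piece next to \<open>t\<close>; the count starts at one piece for
  \<open>n = 0\<close>.\<close>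

lemma abs_diff_le_mult_modulus:
  assumes "continuous_on {0..1} f" "x \<in> {0..1}" "t \<in> {0..1}" "\<bar>t - x\<bar> \<le> real (Suc n) * \<delta>"
  shows "\<bar>f t - f x\<bar> \<le> real (Suc n) * modulus f \<delta>"
  using assms(3,4)
proof (induction n arbitrary: t)
  case 0
  then show ?case
    using modulus_ge[OF assms(1) 0(1) assms(2)] by simp
next
  case (Suc n)
  \<comment> \<open>\<open>y\<close> is the last division point before \<open>t\<close>: it leaves
    \<open>Suc n\<close> pieces towards \<open>x\<close> and exactly one towards
    \<open>t\<close>.\<close>
  define s where "s = real (Suc n) / real (Suc (Suc n))"
  define y where "y = (1 - s) * x + s * t"
  have s: "0 \<le> s" "s \<le> 1" "s * real (Suc (Suc n)) = real (Suc n)"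
    "(1 - s) * real (Suc (Suc n)) = 1"
    by (auto simp: s_def field_simps)
  have y: "y \<in> {0..1}"
    unfolding y_def using convexD[OF convex_real_interval(5)[of 0 1] assms(2) Suc.prems(1), of "1 - s" s] s
    by simp
  have "y - x = s * (t - x)" "t - y = (1 - s) * (t - x)"
    by (simp_all add: y_def algebra_simps)
  then have "\<bar>y - x\<bar> = s * \<bar>t - x\<bar>" "\<bar>t - y\<bar> = (1 - s) * \<bar>t - x\<bar>"
    using s by (simp_all add: abs_mult)
  moreover have "s * \<bar>t - x\<bar> \<le> s * (real (Suc (Suc n)) * \<delta>)"
    using Suc.prems(2) s(1) by (rule mult_left_mono)
  moreover have "(1 - s) * \<bar>t - x\<bar> \<le> (1 - s) * (real (Suc (Suc n)) * \<delta>)"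
    using Suc.prems(2) s(2) by (intro mult_left_mono) auto
  ultimately have "\<bar>y - x\<bar> \<le> real (Suc n) * \<delta>" "\<bar>t - y\<bar> \<le> \<delta>"
    unfolding mult.assoc[symmetric] s by simp_all
  then have "\<bar>f y - f x\<bar> \<le> real (Suc n) * modulus f \<delta>" "\<bar>f t - f y\<bar> \<le> modulus f \<delta>"
    using Suc.IH[OF y] modulus_ge[OF assms(1) Suc.prems(1) y] by auto
  then show ?case
    by (simp add: algebra_simps)
qed

text \<open>With \<open>r = \<bar>t - x\<bar> / \<delta>\<close>, one piece is enough if
  \<open>r \<le> 1\<close>. Otherwise at most \<open>1 + r\<close> pieces are needed, and
  \<open>r \<le> r\<^sup>2\<close> turns the linear growth into a quadratic one, the form that the
  second moment can measure.\<close>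

lemma abs_diff_le_modulus_quadratic:
  assumes f: "continuous_on {0..1} f" "x \<in> {0..1}" "t \<in> {0..1}" and \<delta>: "0 < \<delta>"
  shows "\<bar>f t - f x\<bar> \<le> modulus f \<delta> + modulus f \<delta> / \<delta>\<^sup>2 * (t - x)\<^sup>2"
proof -
  define r where "r = \<bar>t - x\<bar> / \<delta>"
  have r: "0 \<le> r" "\<bar>t - x\<bar> = r * \<delta>" "r\<^sup>2 = (t - x)\<^sup>2 / \<delta>\<^sup>2"
    using \<delta> by (auto simp: r_def power_divide)
  have w: "0 \<le> modulus f \<delta>"
    using f(1) \<delta> by (simp add: modulus_nonneg)
  have "\<bar>f t - f x\<bar> \<le> (1 + r\<^sup>2) * modulus f \<delta>"
  proof (cases "r \<le> 1")
    case True
    then have "\<bar>t - x\<bar> \<le> \<delta>"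
      using r \<delta> by simp
    then have "\<bar>f t - f x\<bar> \<le> modulus f \<delta>"
      using modulus_ge[OF f(1) f(3) f(2)] by blast
    also have "\<dots> \<le> (1 + r\<^sup>2) * modulus f \<delta>"
      using w by (simp add: algebra_simps)
    finally show ?thesis .
  next
    case False
    define n where "n = nat \<lfloor>r\<rfloor>"
    have n: "real n \<le> r" "r \<le> real (Suc n)"
      using r(1) unfolding n_def by linarith+
    have "\<bar>t - x\<bar> \<le> real (Suc n) * \<delta>"
      unfolding r(2) using n(2) \<delta> by (intro mult_right_mono) auto
    then have "\<bar>f t - f x\<bar> \<le> real (Suc n) * modulus f \<delta>"
      by (rule abs_diff_le_mult_modulus[OF f])
    also have "r \<le> r\<^sup>2"
      using False by (simp add: power2_eq_square)
    then have "real (Suc n) * modulus f \<delta> \<le> (1 + r\<^sup>2) * modulus f \<delta>"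
      using n(1) w by (intro mult_right_mono) auto
    finally show ?thesis .
  qed
  then show ?thesis
    by (simp add: r(3) algebra_simps)
qed

text \<open>The parameter \<open>\<epsilon>\<close> stays free because the best choice depends on
  the norms of \<open>L 1\<close> and of the second moment, which enter only later.\<close>

lemma abs_diff_le_deriv_quadratic:
  assumes f: "\<And>x. x \<in> {0..1} \<Longrightarrow> (f has_real_derivative f' x) (at x within {0..1})"
    and f': "continuous_on {0..1} f'" and "x \<in> {0..1}" "t \<in> {0..1}" and \<epsilon>: "0 < \<epsilon>"
  shows "\<bar>f t - f x\<bar> \<le> sup_norm f' * \<epsilon> / 2 + sup_norm f' / (2 * \<epsilon>) * (t - x)\<^sup>2"
proof -
  have "\<bar>f t - f x\<bar> \<le> sup_norm f' * \<bar>t - x\<bar>"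
    using field_differentiable_bound[of "{0..1}" f f' "sup_norm f'" t x] f abs_le_sup_norm[OF f']
      assms(3,4) by simp
  also have "\<bar>t - x\<bar> \<le> \<epsilon> / 2 + (t - x)\<^sup>2 / (2 * \<epsilon>)"
  proof -
    \<comment> \<open>Arithmetic-geometric mean inequality for \<open>\<bar>t - x\<bar>\<close> and
      \<open>\<epsilon>\<close>, divided by \<open>2 * \<epsilon>\<close>.\<close>
    have "0 \<le> (\<bar>t - x\<bar> - \<epsilon>)\<^sup>2 / (2 * \<epsilon>)"
      using \<epsilon> by simp
    also have "\<dots> = \<epsilon> / 2 + \<bar>t - x\<bar>\<^sup>2 / (2 * \<epsilon>) - \<bar>t - x\<bar>"
      unfolding power2_diff using \<epsilon> by (simp add: field_simps power2_eq_square del: power2_abs abs_mult_self_eq)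
    finally show ?thesis by simp
  qed
  then have "sup_norm f' * \<bar>t - x\<bar> \<le> sup_norm f' * (\<epsilon> / 2 + (t - x)\<^sup>2 / (2 * \<epsilon>))"
    by (rule mult_left_mono) (rule sup_norm_nonneg[OF f'])
  finally show ?thesis
    by (simp add: algebra_simps)
qed

section \<open>Continuous functions belong to the shift-continuous space\<close>

lemma space_unit_lborel: "space unit_lborel = {0..1}"
  by (simp add: space_restrict_space)

lemma AE_unit_lborelI: "(\<And>x. x \<in> {0..1} \<Longrightarrow> P x) \<Longrightarrow> AE x in unit_lborel. P x"
  by (rule AE_I2) (simp add: space_unit_lborel)

lemma borel_measurable_unit_lborelI:
  "f \<in> borel_measurable borel \<Longrightarrow> f \<in> borel_measurable unit_lborel"
  by (rule measurable_restrict_space1) simp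

lemma measurable_unit_lborel_continuous:
  fixes f :: "real \<Rightarrow> real"
  assumes "continuous_on {0..1} f"
  shows "f \<in> borel_measurable unit_lborel"
proof -
  have "f \<in> borel_measurable (restrict_space borel {0..1})"
    by (rule borel_measurable_continuous_on_restrict[OF assms])
  moreover have "sets unit_lborel = sets (restrict_space borel {0..1::real})"
    by (rule sets_restrict_space_cong) simp
  ultimately show ?thesis
    using measurable_cong_sets by blast
qed

text \<open>The shift is a translate of the extension of \<open>f\<close> by zero, which is Borel on
  the whole line whatever the values of \<open>f\<close> outside the interval.\<close>

lemma measurable_shift:
  assumes "continuous_on {0..1} f"
  shows "shift \<delta> f \<in> borel_measurable unit_lborel"
proof -
  have "(\<lambda>x. indicator {0..1} x *\<^sub>R f x) \<in> borel_measurable borel"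
    by (rule borel_measurable_continuous_on_indicator[OF _ assms]) simp
  then have "(\<lambda>x. indicator {0..1} (x + \<delta>) *\<^sub>R f (x + \<delta>)) \<in> borel_measurable borel"
    by measurable
  moreover have "shift \<delta> f = (\<lambda>x. indicator {0..1} (x + \<delta>) *\<^sub>R f (x + \<delta>))"
    by (auto simp: fun_eq_iff shift_def indicator_def)
  ultimately show ?thesis
    by (simp add: borel_measurable_unit_lborelI)
qed

text \<open>As long as \<open>x + \<delta>\<close> stays in the interval the modulus applies. On the
  last stretch of length \<open>\<delta>\<close> the shift is 0 and the error is \<open>f x\<close>
  itself.\<close>

lemma abs_shift_diff_le:
  assumes f: "continuous_on {0..1} f" and "x \<in> {0..1}" "0 \<le> \<delta>"
  shows "\<bar>shift \<delta> f x - f x\<bar> \<le> modulus f \<delta> * \<bar>1\<bar> + sup_norm f * \<bar>1 * indicator {1 - \<delta><..1} x\<bar>"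
proof (cases "x + \<delta> \<le> 1")
  case True
  then show ?thesis
    using modulus_ge[OF f, of "x + \<delta>" x \<delta>] assms(2,3) by (simp add: shift_def)
next
  case False
  then show ?thesis
    using abs_le_sup_norm[OF f assms(2)] modulus_nonneg[OF f assms(3)] assms(2)
    by (simp add: shift_def)
qed

lemma modulus_tendsto_0:
  assumes f: "continuous_on {0..1} f"
  shows "(modulus f \<longlongrightarrow> 0) (at_right 0)"
proof (rule tendstoI)
  fix e :: real assume "0 < e"
  have "uniformly_continuous_on {0..1} f"
    by (rule compact_uniformly_continuous[OF f compact_Icc])
  \<comment> \<open>Half of \<open>e\<close>, because passing to the supremum turns the strict bound
    into a weak one.\<close>
  then obtain d where "0 < d"
    and d: "\<And>x y. x \<in> {0..1} \<Longrightarrow> y \<in> {0..1} \<Longrightarrow> \<bar>x - y\<bar> < d \<Longrightarrow> \<bar>f x - f y\<bar> < e / 2"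
    using \<open>0 < e\<close> unfolding uniformly_continuous_on_def dist_real_def
    by (metis half_gt_zero)
  have "dist (modulus f \<delta>) 0 < e" if "0 < \<delta>" "\<delta> < d" for \<delta>
  proof -
    have "modulus f \<delta> \<le> e / 2"
      unfolding modulus_def
    proof (rule cSup_least)
      show "{\<bar>f x - f y\<bar> | x y. x \<in> {0..1} \<and> y \<in> {0..1} \<and> \<bar>x - y\<bar> \<le> \<delta>} \<noteq> {}"
        using that by (auto intro!: exI[of _ "0::real"])
    qed (use d that in force)
    then show ?thesis
      using modulus_nonneg[OF f, of \<delta>] that \<open>0 < e\<close> by (simp add: dist_real_def)
  qed
  then show "\<forall>\<^sub>F \<delta> in at_right 0. dist (modulus f \<delta>) 0 < e"
    using \<open>0 < d\<close> by (auto simp: eventually_at_right_field intro!: exI[of _ d])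
qed

lemma continuous_in_bfs:
  assumes \<rho>: "function_norm unit_lborel \<rho>" and 1: "(\<lambda>_. 1) \<in> abs_cont_norm unit_lborel \<rho>"
    and f: "continuous_on {0..1} f"
  shows "f \<in> bfs unit_lborel \<rho>"
proof -
  have m: "f \<in> borel_measurable unit_lborel"
    by (rule measurable_unit_lborel_continuous[OF f])
  have "bfs_norm \<rho> f \<le> ennreal (sup_norm f) * bfs_norm \<rho> (\<lambda>_. 1) + ennreal 0 * bfs_norm \<rho> (\<lambda>_. 1)"
    by (rule bfs_norm_dominated[OF \<rho> m])
      (auto intro!: AE_unit_lborelI abs_le_sup_norm f sup_norm_nonneg)
  also have "\<dots> < \<infinity>"
    using 1 by (simp add: abs_cont_norm_def bfs_def ennreal_mult_less_top)
  finally show ?thesis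
    using m by (simp add: bfs_def)
qed

text \<open>The shift error is at most \<open>modulus f \<delta>\<close> times the norm of 1, plus
  \<open>sup_norm f\<close> times the norm of the indicator of \<open>{1 - \<delta><..1}\<close>.
  Uniform continuity removes the first term; the absolutely continuous norm of 1 removes the
  second.\<close>

lemma continuous_in_shift_continuous:
  assumes \<rho>: "function_norm unit_lborel \<rho>" and 1: "(\<lambda>_. 1) \<in> abs_cont_norm unit_lborel \<rho>"
    and f: "continuous_on {0..1} f"
  shows "f \<in> shift_continuous \<rho>"
proof -
  have "((\<lambda>\<delta>. bfs_norm \<rho> (\<lambda>x. shift \<delta> f x - f x)) \<longlongrightarrow> 0) (at_right 0)"
    \<comment> \<open>Absolute continuity of the norm speaks of sequences of sets, so the limit is
      tested along sequences \<open>d\<close> tending to 0 from the right.\<close>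
    unfolding tendsto_at_iff_sequentially
  proof (intro allI impI)
    fix d :: "nat \<Rightarrow> real"
    assume d: "\<forall>n. d n \<in> {0<..} - {0}" "d \<longlonglongrightarrow> 0"
    then have pos: "0 < d n" for n
      by auto
    define E where "E n = {1 - d n<..1} \<inter> {0..1}" for n
    have E: "E n \<in> sets unit_lborel" for n
      by (simp add: E_def sets_restrict_space_iff)
    \<comment> \<open>The point 1 lies in every \<open>E n\<close>, so the indicators converge to 0
      only off this null set.\<close>
    have "AE x in unit_lborel. x \<noteq> 1"
      by (subst AE_restrict_space_iff) (auto intro: AE_mp[OF AE_lborel_singleton])
    moreover have "(\<lambda>n. indicator (E n) x :: real) \<longlonglongrightarrow> 0" if "x \<noteq> 1" for x
    proof (cases "x < 1")
      case True
      then have "\<forall>\<^sub>F n in sequentially. d n < 1 - x"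
        using order_tendstoD(2)[OF d(2), of "1 - x"] by simp
      then have "\<forall>\<^sub>F n in sequentially. indicator (E n) x = (0::real)"
        by eventually_elim (auto simp: E_def)
      then show ?thesis
        by (rule tendsto_eventually)
    qed (use that in \<open>simp add: E_def\<close>)
    ultimately have "AE x in unit_lborel. (\<lambda>n. indicator (E n) x :: real) \<longlonglongrightarrow> 0"
      by (auto elim!: eventually_mono)
    then have lim: "(\<lambda>n. bfs_norm \<rho> (\<lambda>x. 1 * indicator (E n) x)) \<longlonglongrightarrow> 0"
      using 1 E by (simp add: abs_cont_norm_def)
    have "filterlim d (at_right 0) sequentially"
      using d pos by (simp add: filterlim_at less_imp_neq[THEN not_sym])
    then have mod: "(\<lambda>n. modulus f (d n)) \<longlonglongrightarrow> 0"
      by (rule filterlim_compose[OF modulus_tendsto_0[OF f]])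
    have le: "bfs_norm \<rho> (\<lambda>x. shift (d n) f x - f x) \<le>
        ennreal (modulus f (d n)) * bfs_norm \<rho> (\<lambda>_. 1) +
        ennreal (sup_norm f) * bfs_norm \<rho> (\<lambda>x. 1 * indicator (E n) x)" for n
    proof (rule bfs_norm_dominated[OF \<rho>])
      show "(\<lambda>x. shift (d n) f x - f x) \<in> borel_measurable unit_lborel"
        by (intro borel_measurable_diff measurable_shift measurable_unit_lborel_continuous f)
      show "(\<lambda>x. 1 * indicator (E n) x :: real) \<in> borel_measurable unit_lborel"
        using E[of n] by simp
      show "AE x in unit_lborel. \<bar>shift (d n) f x - f x\<bar> \<le>
          modulus f (d n) * \<bar>1\<bar> + sup_norm f * \<bar>1 * indicator (E n) x\<bar>"
      proof (rule AE_unit_lborelI)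
        fix x :: real assume x: "x \<in> {0..1}"
        then have "indicator (E n) x = (indicator {1 - d n<..1} x :: real)"
          by (simp add: E_def indicator_def)
        then show "\<bar>shift (d n) f x - f x\<bar> \<le>
            modulus f (d n) * \<bar>1\<bar> + sup_norm f * \<bar>1 * indicator (E n) x\<bar>"
          using abs_shift_diff_le[OF f x, of "d n"] pos[of n] by simp
      qed
    qed (use pos[of n] f in \<open>auto intro: modulus_nonneg sup_norm_nonneg\<close>)
    \<comment> \<open>A finite factor makes the extended product continuous where the modulus tends
      to 0.\<close>
    have fin: "bfs_norm \<rho> (\<lambda>_. 1) < top"
      using 1 by (simp add: abs_cont_norm_def bfs_def)
    have "(\<lambda>n. ennreal (modulus f (d n)) * bfs_norm \<rho> (\<lambda>_. 1)) \<longlonglongrightarrow> ennreal 0 * bfs_norm \<rho> (\<lambda>_. 1)"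
      using fin by (intro tendsto_mult_ennreal tendsto_ennrealI mod) auto
    moreover have "(\<lambda>n. ennreal (sup_norm f) * bfs_norm \<rho> (\<lambda>x. 1 * indicator (E n) x))
        \<longlonglongrightarrow> ennreal (sup_norm f) * 0"
      by (rule ennreal_tendsto_cmult[OF _ lim]) simp
    ultimately have "(\<lambda>n. ennreal (modulus f (d n)) * bfs_norm \<rho> (\<lambda>_. 1) +
        ennreal (sup_norm f) * bfs_norm \<rho> (\<lambda>x. 1 * indicator (E n) x)) \<longlonglongrightarrow>
        ennreal 0 * bfs_norm \<rho> (\<lambda>_. 1) + ennreal (sup_norm f) * 0"
      by (rule tendsto_add)
    then have "(\<lambda>n. ennreal (modulus f (d n)) * bfs_norm \<rho> (\<lambda>_. 1) +
        ennreal (sup_norm f) * bfs_norm \<rho> (\<lambda>x. 1 * indicator (E n) x)) \<longlonglongrightarrow> 0"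
      by simp
    then have "(\<lambda>n. bfs_norm \<rho> (\<lambda>x. shift (d n) f x - f x)) \<longlonglongrightarrow> 0"
      by (rule tendsto_sandwich[OF _ _ tendsto_const, rotated 2]) (use le in auto)
    then show "((\<lambda>\<delta>. bfs_norm \<rho> (\<lambda>x. shift \<delta> f x - f x)) \<circ> d) \<longlonglongrightarrow> 0"
      by (simp add: o_def)
  qed
  then show ?thesis
    using continuous_in_bfs[OF \<rho> 1 f] by (simp add: shift_continuous_def)
qed

lemma continuous_in_bfs_S:
  assumes \<rho>: "function_norm unit_lborel \<rho>" and 1: "(\<lambda>_. 1) \<in> abs_cont_norm unit_lborel \<rho>"
    and f: "continuous_on {0..1} f"
  shows "f \<in> bfs_S \<rho>"
proof -
  have "bfs_norm \<rho> (\<lambda>x. f x - f x) = 0"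
    by (rule bfs_norm_eq_0[OF \<rho>]) auto
  then show ?thesis
    using continuous_in_bfs[OF \<rho> 1 f] continuous_in_shift_continuous[OF \<rho> 1 f]
    by (auto simp: bfs_S_def intro!: bexI[of _ f])
qed

section \<open>The a.e. estimate for positive operators\<close>

text \<open>A dense set stays dense inside an open set, hence the open interval; its closure
  restores the endpoints.\<close>

lemma closure_unit_interval_Rats: "closure ({0<..<1} \<inter> \<rat>) = {0..1::real}"
proof -
  have "closure ({0<..<1} \<inter> \<rat>) = closure {0<..<1::real}"
    by (rule closure_open_Int_superset) (auto simp: Rats_closure_real)
  then show ?thesis
    by simp
qed

text \<open>Four summands fit the test functions built from 1, \<open>t\<close>,
  \<open>t\<^sup>2\<close> and \<open>f\<close>. Coefficients 0 and 1 in the assumption supply every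
  partial sum, and only finitely many null sets are discarded.\<close>

lemma positive_linear_operator_lincomb:
  assumes L: "positive_linear_operator M V L"
    and V: "\<And>a b d e. (\<lambda>t. a * p t + b * q t + d * r t + e * s t) \<in> V"
  shows "AE x in M. L (\<lambda>t. a * p t + b * q t + d * r t + e * s t) x
    = a * L p x + b * L q x + d * L r x + e * L s x"
proof -
  note add = L[unfolded positive_linear_operator_def, THEN conjunct2, THEN conjunct2,
      THEN conjunct1, rule_format]
  note cmult = L[unfolded positive_linear_operator_def, THEN conjunct2, THEN conjunct2,
      THEN conjunct2, THEN conjunct1, rule_format]
  have p: "p \<in> V" "q \<in> V" "r \<in> V" "s \<in> V"
    using V[of 1 0 0 0] V[of 0 1 0 0] V[of 0 0 1 0] V[of 0 0 0 1] by simp_all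
  have ap: "(\<lambda>t. a * p t) \<in> V" "(\<lambda>t. b * q t) \<in> V" "(\<lambda>t. d * r t) \<in> V" "(\<lambda>t. e * s t) \<in> V"
    using V[of a 0 0 0] V[of 0 b 0 0] V[of 0 0 d 0] V[of 0 0 0 e] by simp_all
  have ab: "(\<lambda>t. a * p t + b * q t) \<in> V" "(\<lambda>t. a * p t + b * q t + d * r t) \<in> V"
    using V[of a b 0 0] V[of a b d 0] by simp_all
  show ?thesis
    using add[OF ab(2) ap(4)] add[OF ab(1) ap(3)] add[OF ap(1,2)]
      cmult[OF p(1), of a] cmult[OF p(2), of b] cmult[OF p(3), of d] cmult[OF p(4), of e]
    by eventually_elim simp
qed

text \<open>
  For fixed \<open>q\<close> positivity bounds \<open>L f - f q * L 1\<close> only outside a null set depending on \<open>q\<close>;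
  hence the estimate is taken at rational \<open>q\<close> and extended to \<open>q = x\<close> by continuity.
\<close>

lemma positive_linear_operator_quadratic_bound:
  assumes L: "positive_linear_operator unit_lborel V L"
    and V: "\<And>g. continuous_on {0..1} g \<Longrightarrow> g \<in> V"
    and f: "continuous_on {0..1} f"
    and bound: "\<And>x t. x \<in> {0..1} \<Longrightarrow> t \<in> {0..1} \<Longrightarrow> \<bar>f t - f x\<bar> \<le> A + B * (t - x)\<^sup>2"
  shows "AE x in unit_lborel. \<bar>L f x - f x * L (\<lambda>_. 1) x\<bar> \<le> A * L (\<lambda>_. 1) x + B * second_moment L x"
proof -
  define Q where "Q = {0<..<1::real} \<inter> \<rat>"
  \<comment> \<open>The slack of the claimed bound with the centre \<open>q\<close> detached from
    the evaluation point \<open>x\<close>; the claim is \<open>0 \<le> G x x\<close>.\<close>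
  define G where "G x q = A * L (\<lambda>_. 1) x
      + B * (q\<^sup>2 * L (\<lambda>_. 1) x - 2 * q * L (\<lambda>t. t) x + L (\<lambda>t. t\<^sup>2) x)
      - \<bar>L f x - f q * L (\<lambda>_. 1) x\<bar>" for x q
  have pos: "AE x in unit_lborel. 0 \<le> L g x"
    if "continuous_on {0..1} g" "\<And>t. t \<in> {0..1} \<Longrightarrow> 0 \<le> g t" for g
  proof -
    have "AE x in unit_lborel. 0 \<le> g x"
      by (rule AE_unit_lborelI) (rule that(2))
    then show ?thesis
      using L V[OF that(1)] by (auto simp: positive_linear_operator_def)
  qed
  have "AE x in unit_lborel. 0 \<le> G x q" if "q \<in> Q" for q
  proof -
    have q: "q \<in> {0..1}"
      using that by (auto simp: Q_def)
    \<comment> \<open>The signs \<open>e = 1\<close> and \<open>e = - 1\<close> give the two halves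
      of the absolute value. Positivity is applied to
      \<open>A + B * (t - q)\<^sup>2 + e * (f t - f q)\<close>, expanded in 1, \<open>t\<close>,
      \<open>t\<^sup>2\<close> and \<open>f\<close>.\<close>
    have ge: "AE x in unit_lborel. 0 \<le> (A + B * q\<^sup>2 - e * f q) * L (\<lambda>_. 1) x + (- 2 * B * q) * L (\<lambda>t. t) x
        + B * L (\<lambda>t. t\<^sup>2) x + e * L f x" if e: "\<bar>e\<bar> = 1" for e
    proof -
      let ?g = "\<lambda>t. (A + B * q\<^sup>2 - e * f q) * 1 + (- 2 * B * q) * t + B * t\<^sup>2 + e * f t"
      have "AE x in unit_lborel. 0 \<le> L ?g x"
      proof (rule pos)
        fix t :: real assume t: "t \<in> {0..1}"
        have "?g t = A + B * (t - q)\<^sup>2 + e * (f t - f q)"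
          by (simp add: power2_eq_square algebra_simps)
        moreover have "\<bar>e * (f t - f q)\<bar> \<le> A + B * (t - q)\<^sup>2"
          using bound[OF q t] e by (simp add: abs_mult)
        ultimately show "0 \<le> ?g t"
          by linarith
      qed (intro continuous_intros f)
      moreover have "AE x in unit_lborel. L ?g x = (A + B * q\<^sup>2 - e * f q) * L (\<lambda>_. 1) x
          + (- 2 * B * q) * L (\<lambda>t. t) x + B * L (\<lambda>t. t\<^sup>2) x + e * L f x"
        by (rule positive_linear_operator_lincomb[OF L]) (intro V continuous_intros f)
      ultimately show ?thesis
        by eventually_elim simp
    qed
    have e: "\<bar>1 :: real\<bar> = 1" "\<bar>- 1 :: real\<bar> = 1"
      by simp_all
    from ge[OF e(1)] ge[OF e(2)] show ?thesis
      by eventually_elim (auto simp: G_def algebra_simps abs_if)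
  qed
  moreover have "countable Q"
    by (simp add: Q_def countable_rat)
  ultimately have "AE x in unit_lborel. \<forall>q\<in>Q. 0 \<le> G x q"
    by (simp add: AE_ball_countable)
  moreover have "AE x in unit_lborel. x \<in> {0..1}"
    by (rule AE_unit_lborelI)
  ultimately show ?thesis
  proof eventually_elim
    case (elim x)
    \<comment> \<open>For fixed \<open>x\<close> the values of \<open>L\<close> are constants, so
      \<open>G x\<close> depends on \<open>q\<close> only through polynomials and
      \<open>f q\<close>.\<close>
    have "continuous_on (closure Q) (G x)"
      unfolding G_def Q_def closure_unit_interval_Rats by (intro continuous_intros f)
    then have "0 \<le> G x x"
      by (rule continuous_ge_on_closure)
        (use elim in \<open>auto simp: Q_def closure_unit_interval_Rats\<close>)
    then show ?case
      by (simp add: G_def second_moment_def)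
  qed
qed

section \<open>Norm estimates for a single operator\<close>

text \<open>Split \<open>L f - f\<close> into \<open>f\<close> times \<open>L 1 - 1\<close>, which
  measures the failure to reproduce constants, and \<open>L f - f * L 1\<close>, which the a.e.
  estimate controls.\<close>

lemma bfs_norm_quadratic_bound:
  assumes \<rho>: "function_norm unit_lborel \<rho>" and 1: "(\<lambda>_. 1) \<in> abs_cont_norm unit_lborel \<rho>"
    and L: "positive_linear_operator unit_lborel (bfs_S \<rho>) L"
    and f: "continuous_on {0..1} f" and nn: "0 \<le> A" "0 \<le> B"
    and bound: "\<And>x t. x \<in> {0..1} \<Longrightarrow> t \<in> {0..1} \<Longrightarrow> \<bar>f t - f x\<bar> \<le> A + B * (t - x)\<^sup>2"
  shows "bfs_norm \<rho> (\<lambda>x. L f x - f x) \<le> ennreal (sup_norm f) * bfs_norm \<rho> (\<lambda>x. L (\<lambda>_. 1) x - 1)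
    + (ennreal A * bfs_norm \<rho> (L (\<lambda>_. 1)) + ennreal B * bfs_norm \<rho> (second_moment L))"
proof -
  note V = continuous_in_bfs_S[OF \<rho> 1]
  have m: "L g \<in> borel_measurable unit_lborel" if "continuous_on {0..1} g" for g
    using L V[OF that] by (auto simp: positive_linear_operator_def bfs_S_def bfs_def)
  have [measurable]: "L (\<lambda>_. 1) \<in> borel_measurable unit_lborel" "L f \<in> borel_measurable unit_lborel"
    "f \<in> borel_measurable unit_lborel" "(\<lambda>x. x) \<in> borel_measurable unit_lborel"
    "L (\<lambda>t. t) \<in> borel_measurable unit_lborel" "L (\<lambda>t. t\<^sup>2) \<in> borel_measurable unit_lborel"
    by (intro m measurable_unit_lborel_continuous continuous_intros f)+
  have [measurable]: "second_moment L \<in> borel_measurable unit_lborel"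
    unfolding second_moment_def[abs_def] by simp
  have "bfs_norm \<rho> (\<lambda>x. L f x - f x) \<le> ennreal (sup_norm f) * bfs_norm \<rho> (\<lambda>x. L (\<lambda>_. 1) x - 1)
      + ennreal 1 * bfs_norm \<rho> (\<lambda>x. L f x - f x * L (\<lambda>_. 1) x)"
  proof (rule bfs_norm_dominated[OF \<rho>])
    show "AE x in unit_lborel. \<bar>L f x - f x\<bar> \<le>
        sup_norm f * \<bar>L (\<lambda>_. 1) x - 1\<bar> + 1 * \<bar>L f x - f x * L (\<lambda>_. 1) x\<bar>"
    proof (rule AE_unit_lborelI)
      fix x :: real assume "x \<in> {0..1}"
      then have "\<bar>f x * (L (\<lambda>_. 1) x - 1)\<bar> \<le> sup_norm f * \<bar>L (\<lambda>_. 1) x - 1\<bar>"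
        unfolding abs_mult by (intro mult_right_mono abs_le_sup_norm f) auto
      moreover have "\<bar>f x * (L (\<lambda>_. 1) x - 1) + (L f x - f x * L (\<lambda>_. 1) x)\<bar>
          \<le> \<bar>f x * (L (\<lambda>_. 1) x - 1)\<bar> + \<bar>L f x - f x * L (\<lambda>_. 1) x\<bar>"
        by (rule abs_triangle_ineq)
      moreover have "f x * (L (\<lambda>_. 1) x - 1) + (L f x - f x * L (\<lambda>_. 1) x) = L f x - f x"
        by (simp add: algebra_simps)
      ultimately show "\<bar>L f x - f x\<bar> \<le>
          sup_norm f * \<bar>L (\<lambda>_. 1) x - 1\<bar> + 1 * \<bar>L f x - f x * L (\<lambda>_. 1) x\<bar>"
        unfolding mult_1 by (metis add_right_mono order_trans)
    qed
  qed (use sup_norm_nonneg[OF f] in simp_all)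
  moreover have "bfs_norm \<rho> (\<lambda>x. L f x - f x * L (\<lambda>_. 1) x) \<le>
      ennreal A * bfs_norm \<rho> (L (\<lambda>_. 1)) + ennreal B * bfs_norm \<rho> (second_moment L)"
  proof (rule bfs_norm_dominated[OF \<rho> _ _ _ nn])
    show "AE x in unit_lborel. \<bar>L f x - f x * L (\<lambda>_. 1) x\<bar> \<le>
        A * \<bar>L (\<lambda>_. 1) x\<bar> + B * \<bar>second_moment L x\<bar>"
    proof -
      have "AE x in unit_lborel. \<bar>L f x - f x * L (\<lambda>_. 1) x\<bar>
          \<le> A * L (\<lambda>_. 1) x + B * second_moment L x"
        by (rule positive_linear_operator_quadratic_bound[OF L V f bound])
      then show ?thesis
      proof eventually_elim
        case (elim x)
        moreover have "A * L (\<lambda>_. 1) x \<le> A * \<bar>L (\<lambda>_. 1) x\<bar>"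
          "B * second_moment L x \<le> B * \<bar>second_moment L x\<bar>"
          using nn by (simp_all add: mult_left_mono)
        ultimately show ?case
          by linarith
      qed
    qed
  qed simp_all
  ultimately show ?thesis
    by (simp add: add_left_mono order_trans)
qed

lemma bfs_norm_modulus_bound:
  assumes \<rho>: "function_norm unit_lborel \<rho>" and 1: "(\<lambda>_. 1) \<in> abs_cont_norm unit_lborel \<rho>"
    and L: "positive_linear_operator unit_lborel (bfs_S \<rho>) L"
    and f: "continuous_on {0..1} f"
    and \<mu>: "0 \<le> \<mu>" "ennreal (\<mu>\<^sup>2) = bfs_norm \<rho> (second_moment L)"
    and fin: "bfs_norm \<rho> (L (\<lambda>_. 1)) < \<infinity>"
  shows "bfs_norm \<rho> (\<lambda>x. L f x - f x) \<le> ennreal (sup_norm f) * bfs_norm \<rho> (\<lambda>x. L (\<lambda>_. 1) x - 1)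
    + (bfs_norm \<rho> (L (\<lambda>_. 1)) + 1) * ennreal (modulus f \<mu>)"
proof -
  have bound: "bfs_norm \<rho> (\<lambda>x. L f x - f x) \<le> ennreal (sup_norm f) * bfs_norm \<rho> (\<lambda>x. L (\<lambda>_. 1) x - 1)
      + (ennreal (modulus f \<delta>) * bfs_norm \<rho> (L (\<lambda>_. 1)) + ennreal (modulus f \<delta> / \<delta>\<^sup>2) * ennreal (\<mu>\<^sup>2))"
    if "0 < \<delta>" for \<delta>
    unfolding \<mu>(2) using that modulus_nonneg[OF f, of \<delta>]
    by (intro bfs_norm_quadratic_bound[OF \<rho> 1 L f] abs_diff_le_modulus_quadratic f) auto
  show ?thesis
  proof (cases "\<mu> = 0")
    case True
    \<comment> \<open>Since \<open>\<mu> = 0\<close>, the second-moment term vanishes for every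
      \<open>\<delta> > 0\<close>; the remaining modulus term tends to 0 because the norm of
      \<open>L 1\<close> is finite.\<close>
    have "((\<lambda>\<delta>. ennreal (modulus f \<delta>) * bfs_norm \<rho> (L (\<lambda>_. 1))) \<longlongrightarrow>
        ennreal 0 * bfs_norm \<rho> (L (\<lambda>_. 1))) (at_right 0)"
      using fin by (intro tendsto_mult_ennreal tendsto_ennrealI modulus_tendsto_0 f) auto
    then have "((\<lambda>\<delta>. ennreal (sup_norm f) * bfs_norm \<rho> (\<lambda>x. L (\<lambda>_. 1) x - 1)
        + ennreal (modulus f \<delta>) * bfs_norm \<rho> (L (\<lambda>_. 1))) \<longlongrightarrow>
        ennreal (sup_norm f) * bfs_norm \<rho> (\<lambda>x. L (\<lambda>_. 1) x - 1)
        + ennreal 0 * bfs_norm \<rho> (L (\<lambda>_. 1))) (at_right 0)"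
      by (intro tendsto_add tendsto_const)
    then have "bfs_norm \<rho> (\<lambda>x. L f x - f x) \<le>
        ennreal (sup_norm f) * bfs_norm \<rho> (\<lambda>x. L (\<lambda>_. 1) x - 1) + ennreal 0 * bfs_norm \<rho> (L (\<lambda>_. 1))"
      by (rule tendsto_lowerbound)
        (use bound True in \<open>auto simp: eventually_at_right_field intro!: exI[of _ 1]\<close>)
    then show ?thesis
      by (simp add: True modulus_0)
  next
    case False
    then have "0 < \<mu>"
      using \<mu>(1) by simp
    then have "ennreal (modulus f \<mu> / \<mu>\<^sup>2) * ennreal (\<mu>\<^sup>2) = ennreal (modulus f \<mu>)"
      using modulus_nonneg[OF f \<mu>(1)] by (simp add: ennreal_mult[symmetric])
    then show ?thesis
      using bound[OF \<open>0 < \<mu>\<close>] by (simp add: distrib_left mult.commute)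
  qed
qed

text \<open>The derivative bound contributes at most
  \<open>K / 2 * (c * \<epsilon> + \<mu>\<^sup>2 / \<epsilon>)\<close> with
  \<open>K = sup_norm f'\<close>. For positive \<open>c\<close> and \<open>\<mu>\<close> its minimum
  over \<open>\<epsilon>\<close> is \<open>K * sqrt c * \<mu>\<close>; a perturbed minimiser and a
  limit reach this value in all cases.\<close>

lemma bfs_norm_deriv_bound:
  assumes \<rho>: "function_norm unit_lborel \<rho>" and 1: "(\<lambda>_. 1) \<in> abs_cont_norm unit_lborel \<rho>"
    and L: "positive_linear_operator unit_lborel (bfs_S \<rho>) L"
    and f: "\<And>x. x \<in> {0..1} \<Longrightarrow> (f has_real_derivative f' x) (at x within {0..1})"
    and f': "continuous_on {0..1} f'"
    and \<mu>: "0 \<le> \<mu>" "ennreal (\<mu>\<^sup>2) = bfs_norm \<rho> (second_moment L)"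
    and c: "0 \<le> c" "bfs_norm \<rho> (L (\<lambda>_. 1)) \<le> ennreal c"
  shows "bfs_norm \<rho> (\<lambda>x. L f x - f x) \<le> ennreal (sup_norm f) * bfs_norm \<rho> (\<lambda>x. L (\<lambda>_. 1) x - 1)
    + ennreal (sqrt c * \<mu> * sup_norm f')"
proof -
  let ?N = "ennreal (sup_norm f) * bfs_norm \<rho> (\<lambda>x. L (\<lambda>_. 1) x - 1)"
  define a where "a = sqrt c"
  define K where "K = sup_norm f'"
  have a: "0 \<le> a" "c = a\<^sup>2" and K: "0 \<le> K"
    using c sup_norm_nonneg[OF f'] by (simp_all add: a_def K_def)
  have cont: "continuous_on {0..1} f"
    using f by (rule DERIV_continuous_on)
  have bound: "bfs_norm \<rho> (\<lambda>x. L f x - f x) \<le> ?N + ennreal (K * (a * \<mu> + \<eta> * (a + \<mu>) / 2))"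
    if \<eta>: "0 < \<eta>" for \<eta>
  proof -
    \<comment> \<open>The optimal choice would be \<open>\<mu> / a\<close>; the summand \<open>\<eta>\<close> covers \<open>a = 0\<close> and \<open>\<mu> = 0\<close>.\<close>
    define \<epsilon> where "\<epsilon> = (\<mu> + \<eta>) / (a + \<eta>)"
    have pos: "0 < a + \<eta>" "0 < \<mu> + \<eta>"
      using a \<mu> \<eta> by auto
    then have \<epsilon>: "0 < \<epsilon>"
      by (simp add: \<epsilon>_def)
    have "bfs_norm \<rho> (\<lambda>x. L f x - f x) \<le> ?N + (ennreal (K * \<epsilon> / 2) * bfs_norm \<rho> (L (\<lambda>_. 1))
        + ennreal (K / (2 * \<epsilon>)) * ennreal (\<mu>\<^sup>2))"
      unfolding \<mu>(2) using K \<epsilon> unfolding K_def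
      by (intro bfs_norm_quadratic_bound[OF \<rho> 1 L cont] abs_diff_le_deriv_quadratic f f') auto
    also have "\<dots> \<le> ?N + (ennreal (K * \<epsilon> / 2) * ennreal c + ennreal (K / (2 * \<epsilon>)) * ennreal (\<mu>\<^sup>2))"
      by (intro add_mono mult_left_mono c order_refl) auto
    also have "ennreal (K * \<epsilon> / 2) * ennreal c + ennreal (K / (2 * \<epsilon>)) * ennreal (\<mu>\<^sup>2)
        = ennreal (K / 2 * (a * (a * \<epsilon>) + \<mu> * (\<mu> / \<epsilon>)))"
      using K \<epsilon> c(1) by (simp add: ennreal_mult[symmetric] ennreal_plus[symmetric] a(2)
          power2_eq_square field_simps del: ennreal_plus)
    also have "\<dots> \<le> ennreal (K * (a * \<mu> + \<eta> * (a + \<mu>) / 2))"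
    proof (rule ennreal_leI)
      \<comment> \<open>By the choice of \<open>\<epsilon>\<close>, both follow from
        \<open>a \<le> a + \<eta>\<close> and \<open>\<mu> \<le> \<mu> + \<eta>\<close>; each of the
        two terms then exceeds \<open>a * \<mu>\<close> by a multiple of \<open>\<eta>\<close> at
        most.\<close>
      have "a * \<epsilon> \<le> \<mu> + \<eta>" "\<mu> / \<epsilon> \<le> a + \<eta>"
        using pos a \<mu> \<eta> by (simp_all add: \<epsilon>_def divide_le_eq mult_mono mult.commute)
      then have "a * (a * \<epsilon>) + \<mu> * (\<mu> / \<epsilon>) \<le> a * (\<mu> + \<eta>) + \<mu> * (a + \<eta>)"
        using a \<mu> by (intro add_mono mult_left_mono) auto
      then have "K / 2 * (a * (a * \<epsilon>) + \<mu> * (\<mu> / \<epsilon>)) \<le> K / 2 * (a * (\<mu> + \<eta>) + \<mu> * (a + \<eta>))"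
        using K by (intro mult_left_mono) auto
      also have "\<dots> = K * (a * \<mu> + \<eta> * (a + \<mu>) / 2)"
        by (simp add: field_simps)
      finally show "K / 2 * (a * (a * \<epsilon>) + \<mu> * (\<mu> / \<epsilon>)) \<le> K * (a * \<mu> + \<eta> * (a + \<mu>) / 2)" .
    qed
    finally show ?thesis
      by (simp add: add_left_mono)
  qed
  have "((\<lambda>\<eta>. K * (a * \<mu> + \<eta> * (a + \<mu>) / 2)) \<longlongrightarrow> K * (a * \<mu> + 0 * (a + \<mu>) / 2)) (at_right 0)"
    by (intro tendsto_intros) simp
  then have "((\<lambda>\<eta>. ?N + ennreal (K * (a * \<mu> + \<eta> * (a + \<mu>) / 2))) \<longlongrightarrow>
      ?N + ennreal (K * (a * \<mu> + 0 * (a + \<mu>) / 2))) (at_right 0)"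
    by (intro tendsto_add tendsto_const tendsto_ennrealI)
  then have "bfs_norm \<rho> (\<lambda>x. L f x - f x) \<le> ?N + ennreal (K * (a * \<mu> + 0 * (a + \<mu>) / 2))"
    by (rule tendsto_lowerbound)
      (use bound in \<open>auto simp: eventually_at_right_field intro!: exI[of _ 1]\<close>)
  then show ?thesis
    by (simp add: a_def K_def mult.commute)
qed

section \<open>The estimates for the sequence of operators\<close>

theorem theorem14:
  fixes \<rho> :: "(real \<Rightarrow> real) \<Rightarrow> ennreal"
    and L :: "nat \<Rightarrow> (real \<Rightarrow> real) \<Rightarrow> real \<Rightarrow> real"
    and c :: real
    and \<mu> :: "nat \<Rightarrow> real"
  assumes "function_norm unit_lborel \<rho>"
    and "(\<lambda>_. 1) \<in> abs_cont_norm unit_lborel \<rho>"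
    and "\<And>n. n \<ge> 1 \<Longrightarrow> positive_linear_operator unit_lborel (bfs_S \<rho>) (L n)"
    and "c \<ge> 0"
    and "(SUP n\<in>{1..}. bfs_norm \<rho> (L n (\<lambda>_. 1))) = ennreal c"
    and "\<And>n. n \<ge> 1 \<Longrightarrow> \<mu> n \<ge> 0"
    and "\<And>n. n \<ge> 1 \<Longrightarrow> ennreal ((\<mu> n)\<^sup>2) = bfs_norm \<rho> (second_moment (L n))"
  shows "\<forall>f. continuous_on {0..1} f \<longrightarrow> (\<forall>n\<ge>1.
      (bfs_norm \<rho> (\<lambda>x. L n f x - f x)
         \<le> ennreal (sup_norm f) * bfs_norm \<rho> (\<lambda>x. L n (\<lambda>_. 1) x - 1)
           + (bfs_norm \<rho> (L n (\<lambda>_. 1)) + 1) * ennreal (modulus f (\<mu> n)))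
    \<and> ((AE x in unit_lborel. L n (\<lambda>_. 1) x = 1) \<longrightarrow>
        bfs_norm \<rho> (\<lambda>x. L n f x - f x) \<le> ennreal ((c + 1) * modulus f (\<mu> n)))
    \<and> (\<forall>f'. (\<forall>x\<in>{0..1}. (f has_real_derivative f' x) (at x within {0..1})) \<longrightarrow>
        continuous_on {0..1} f' \<longrightarrow>
          bfs_norm \<rho> (\<lambda>x. L n f x - f x)
            \<le> ennreal (sup_norm f) * bfs_norm \<rho> (\<lambda>x. L n (\<lambda>_. 1) x - 1)
              + ennreal (sqrt c * \<mu> n * sup_norm f' + (sqrt c + 1) * \<mu> n * modulus f' (\<mu> n))
        \<and> ((AE x in unit_lborel. L n (\<lambda>_. 1) x = 1) \<longrightarrow>
            bfs_norm \<rho> (\<lambda>x. L n f x - f x)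
              \<le> ennreal (sqrt c * \<mu> n * sup_norm f' + (sqrt c + 1) * \<mu> n * modulus f' (\<mu> n)))))"
proof (intro allI impI)
  fix f :: "real \<Rightarrow> real" and n :: nat
  assume f: "continuous_on {0..1} f" and n: "1 \<le> n"
  let ?D = "bfs_norm \<rho> (\<lambda>x. L n f x - f x)"
  let ?N = "ennreal (sup_norm f) * bfs_norm \<rho> (\<lambda>x. L n (\<lambda>_. 1) x - 1)"
  note L = assms(3)[OF n] and \<mu> = assms(6)[OF n] assms(7)[OF n]
  have c: "bfs_norm \<rho> (L n (\<lambda>_. 1)) \<le> ennreal c"
    unfolding assms(5)[symmetric] using n by (intro SUP_upper) simp
  have bound: "?D \<le> ?N + (bfs_norm \<rho> (L n (\<lambda>_. 1)) + 1) * ennreal (modulus f (\<mu> n))"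
    using c by (intro bfs_norm_modulus_bound[OF assms(1,2) L f \<mu>]) (auto intro: le_less_trans)
  have N0: "?N = 0" if "AE x in unit_lborel. L n (\<lambda>_. 1) x = 1"
  proof -
    have "L n (\<lambda>_. 1) \<in> borel_measurable unit_lborel"
      using L continuous_in_bfs_S[OF assms(1,2), of "\<lambda>_. 1"]
      by (auto simp: positive_linear_operator_def bfs_S_def bfs_def)
    then have "bfs_norm \<rho> (\<lambda>x. L n (\<lambda>_. 1) x - 1) = 0"
      using that by (intro bfs_norm_eq_0[OF assms(1)]) auto
    then show ?thesis
      by simp
  qed
  have one: "?D \<le> ennreal ((c + 1) * modulus f (\<mu> n))" if "AE x in unit_lborel. L n (\<lambda>_. 1) x = 1"
  proof -
    have "?D \<le> (ennreal c + 1) * ennreal (modulus f (\<mu> n))"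
      using bound unfolding N0[OF that]
      by (rule order_trans) (simp add: mult_right_mono add_right_mono c)
    also have "\<dots> = ennreal ((c + 1) * modulus f (\<mu> n))"
      using assms(4) modulus_nonneg[OF f \<mu>(1)] by (simp add: ennreal_mult)
    finally show ?thesis .
  qed
  have deriv: "?D \<le> ?N + ennreal (sqrt c * \<mu> n * sup_norm f' + (sqrt c + 1) * \<mu> n * modulus f' (\<mu> n))"
    if f': "\<forall>x\<in>{0..1}. (f has_real_derivative f' x) (at x within {0..1})" "continuous_on {0..1} f'"
    for f'
  proof -
    have "?D \<le> ?N + ennreal (sqrt c * \<mu> n * sup_norm f')"
      using f'(1) by (intro bfs_norm_deriv_bound[OF assms(1,2) L _ f'(2) \<mu> assms(4) c]) auto
    \<comment> \<open>The summand with \<open>modulus f'\<close> is nonnegative, so adding it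
      weakens the bound just obtained.\<close>
    also have "\<dots> \<le> ?N + ennreal (sqrt c * \<mu> n * sup_norm f' + (sqrt c + 1) * \<mu> n * modulus f' (\<mu> n))"
      using assms(4) \<mu>(1) modulus_nonneg[OF f'(2) \<mu>(1)] by (intro add_left_mono ennreal_leI) simp
    finally show ?thesis .
  qed
  show "(?D \<le> ?N + (bfs_norm \<rho> (L n (\<lambda>_. 1)) + 1) * ennreal (modulus f (\<mu> n)))
    \<and> ((AE x in unit_lborel. L n (\<lambda>_. 1) x = 1) \<longrightarrow> ?D \<le> ennreal ((c + 1) * modulus f (\<mu> n)))
    \<and> (\<forall>f'. (\<forall>x\<in>{0..1}. (f has_real_derivative f' x) (at x within {0..1})) \<longrightarrow>
        continuous_on {0..1} f' \<longrightarrow>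
          ?D \<le> ?N + ennreal (sqrt c * \<mu> n * sup_norm f' + (sqrt c + 1) * \<mu> n * modulus f' (\<mu> n))
        \<and> ((AE x in unit_lborel. L n (\<lambda>_. 1) x = 1) \<longrightarrow>
            ?D \<le> ennreal (sqrt c * \<mu> n * sup_norm f' + (sqrt c + 1) * \<mu> n * modulus f' (\<mu> n))))"
  proof (intro conjI allI impI)
    fix f' assume "\<forall>x\<in>{0..1}. (f has_real_derivative f' x) (at x within {0..1})"
      and "continuous_on {0..1} f'" and "AE x in unit_lborel. L n (\<lambda>_. 1) x = 1"
    then show "?D \<le> ennreal (sqrt c * \<mu> n * sup_norm f' + (sqrt c + 1) * \<mu> n * modulus f' (\<mu> n))"
      using deriv[of f'] N0 by simp
  qed (fact bound one deriv)+
qed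

end
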